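(* Let $q$ be a prime power, $n\ge 1$ an integer, and $0<\alpha<1$ a real number. Let $L_1,\dots,L_c$ be lines in $\mathbb{F}_q^n$ and $X=\bigcup_{i=1}^c L_i$. On each $L_i$, pick a subset $\gamma_i\subset L_i$ such that $|\gamma_i|>q^\alpha$, and let $Y=\bigcup_{i=1}^c\gamma_i$. Then $$ |X| \leq n!\cdot q^{n(1-\alpha)}\, |Y|. $$
   Context: $\mathbb{F}_q$ is the finite field with $q$ elements. A line is a one-dimensional affine subspace of $\mathbb{F}_q^n$. *)

theory Defs
  imports "HOL-Analysis.Analysis"
begin

text \<open>
  The field \<open>\<bbbF>\<^sub>q\<close> is rendered as an arbitrary finite type \<open>'a\<close> of class \<open>field\<close> with \<open>q\<close> elements,
  and \<open>\<bbbF>\<^sub>q\<^sup>n\<close> as \<open>'a ^ 'n\<close> with \<open>CARD('n) = n\<close>. The library's \<open>affine\<close> concerns real vector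
  spaces only, so affine subspaces appear here as translates of linear subspaces over \<open>'a\<close>.
\<close>

definition is_line :: "('a::field ^ 'n) set \<Rightarrow> bool" where
  "is_line L \<longleftrightarrow> (\<exists>p W. vec.subspace W \<and> vec.dim W = 1 \<and> L = (\<lambda>w. p + w) ` W)"

end

theory Submission
  imports Defs
begin

text \<open>
  Let \<open>d = \<lfloor>q\<^sup>\<alpha>\<rfloor>\<close>. A polynomial of degree at most \<open>d\<close> that vanishes on \<open>Y\<close> has more than \<open>d\<close>
  zeros on each line, hence vanishes on \<open>X\<close>. Enumerate the field as \<open>x\<^sub>0, x\<^sub>1, \<dots>\<close> and let \<open>B\<close> be
  the simplex of all points \<open>(x\<^bsub>a\<^sub>1\<^esub>, \<dots>, x\<^bsub>a\<^sub>n\<^esub>)\<close> with \<open>a\<^sub>1 + \<dots> + a\<^sub>n \<le> d\<close>.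
  Newton interpolation shows that polynomials of degree at most \<open>d\<close> take arbitrary values on \<open>B\<close>,
  and so on every translate \<open>B + g\<close>. As the values on \<open>Y\<close> determine those on \<open>X \<inter> (B + g)\<close>, counting
  functions gives \<open>|X \<inter> (B + g)| \<le> |Y|\<close>. Summing over all \<open>g\<close> yields \<open>|X| |B| \<le> q\<^sup>n |Y|\<close>, and
  \<open>|B| = (n + d choose n) \<ge> (d + 1)\<^sup>n / n!\<close>.
\<close>

section \<open>Functions of bounded degree along lines\<close>

text \<open>
  Only the restrictions of polynomials to lines matter, and with the following notion of degree
  no multivariate polynomials are needed and translation invariance is immediate.
\<close>

definition line_degree_le :: "nat \<Rightarrow> ('a::field ^ 'n \<Rightarrow> 'a) \<Rightarrow> bool" where
  "line_degree_le d f \<longleftrightarrow> (\<forall>p v. \<exists>P. degree P \<le> d \<and> (\<forall>t. f (p + t *s v) = poly P t))"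

lemma line_degree_leE:
  assumes "line_degree_le d f"
  obtains P where "degree P \<le> d" "\<And>t. f (p + t *s v) = poly P t"
  using assms unfolding line_degree_le_def by metis

lemma line_degree_le_mono: "line_degree_le d f \<Longrightarrow> d \<le> e \<Longrightarrow> line_degree_le e f"
  unfolding line_degree_le_def by (meson order_trans)

lemma line_degree_le_const: "line_degree_le d (\<lambda>_. c)"
  unfolding line_degree_le_def by (intro allI exI[of _ "[:c:]"]) simp

lemma line_degree_le_coordinate:
  fixes i :: "'n::finite" and c :: "'a::field"
  shows "line_degree_le 1 (\<lambda>y :: 'a ^ 'n. y $ i - c)"
  unfolding line_degree_le_def
proof (intro allI)
  fix p v :: "'a ^ 'n"
  show "\<exists>P. degree P \<le> 1 \<and> (\<forall>t. (p + t *s v) $ i - c = poly P t)"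
    by (rule exI[of _ "[:p $ i - c, v $ i:]"]) simp
qed

lemma line_degree_le_add:
  assumes "line_degree_le d f" "line_degree_le d g"
  shows "line_degree_le d (\<lambda>y. f y + g y)"
  unfolding line_degree_le_def
proof (intro allI)
  fix p v
  obtain P where "degree P \<le> d" "\<And>t. f (p + t *s v) = poly P t"
    using assms(1) by (rule line_degree_leE[where p = p and v = v]) blast
  moreover obtain Q where "degree Q \<le> d" "\<And>t. g (p + t *s v) = poly Q t"
    using assms(2) by (rule line_degree_leE[where p = p and v = v]) blast
  ultimately show "\<exists>R. degree R \<le> d \<and> (\<forall>t. f (p + t *s v) + g (p + t *s v) = poly R t)"
    by (intro exI[of _ "P + Q"]) (simp add: degree_add_le)
qed

lemma line_degree_le_mult:
  assumes "line_degree_le d f" "line_degree_le e g"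
  shows "line_degree_le (d + e) (\<lambda>y. f y * g y)"
  unfolding line_degree_le_def
proof (intro allI)
  fix p v
  obtain P where "degree P \<le> d" "\<And>t. f (p + t *s v) = poly P t"
    using assms(1) by (rule line_degree_leE[where p = p and v = v]) blast
  moreover obtain Q where "degree Q \<le> e" "\<And>t. g (p + t *s v) = poly Q t"
    using assms(2) by (rule line_degree_leE[where p = p and v = v]) blast
  ultimately show "\<exists>R. degree R \<le> d + e \<and> (\<forall>t. f (p + t *s v) * g (p + t *s v) = poly R t)"
    by (intro exI[of _ "P * Q"]) (auto intro: order_trans[OF degree_mult_le])
qed

lemma line_degree_le_cmult: "line_degree_le d f \<Longrightarrow> line_degree_le d (\<lambda>y. c * f y)"
  using line_degree_le_mult[OF line_degree_le_const[of 0]] by simp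

lemma line_degree_le_diff:
  assumes "line_degree_le d f" "line_degree_le d g"
  shows "line_degree_le d (\<lambda>y. f y - g y)"
  using line_degree_le_add[OF assms(1) line_degree_le_cmult[OF assms(2), of "-1"]] by simp

lemma line_degree_le_prod:
  assumes "\<And>i. i \<in> A \<Longrightarrow> line_degree_le (d i) (f i)"
  shows "line_degree_le (\<Sum>i\<in>A. d i) (\<lambda>y. \<Prod>i\<in>A. f i y)"
  using assms
  by (induction A rule: infinite_finite_induct)
     (simp_all add: line_degree_le_const line_degree_le_mult)

lemma line_degree_le_translate:
  assumes "line_degree_le d f"
  shows "line_degree_le d (\<lambda>y. f (y - g))"
  unfolding line_degree_le_def
proof (intro allI)
  fix p v
  obtain P where "degree P \<le> d" "\<And>t. f ((p - g) + t *s v) = poly P t"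
    using assms by (rule line_degree_leE[where p = "p - g" and v = v]) blast
  then show "\<exists>P. degree P \<le> d \<and> (\<forall>t. f (p + t *s v - g) = poly P t)"
    by (intro exI[of _ P]) (simp add: algebra_simps)
qed

section \<open>Vanishing on a line with many zeros\<close>

lemma is_lineE:
  assumes "is_line L"
  obtains p v where "L = range (\<lambda>t. p + t *s v)"
proof -
  obtain p W where W: "vec.subspace W" "vec.dim W = 1" "L = (\<lambda>w. p + w) ` W"
    using assms unfolding is_line_def by blast
  obtain B where B: "B \<subseteq> W" "W \<subseteq> vec.span B" "card B = vec.dim W"
    by (rule vec.basis_exists[of W])
  then obtain v where v: "B = {v}"
    using W(2) by (metis card_1_singletonE)
  have "W = vec.span {v}"
    using B v W(1) by (metis vec.span_minimal subset_antisym)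
  then have "L = range (\<lambda>t. p + t *s v)"
    using W(3) by (simp add: vec.span_singleton image_image)
  then show thesis by (rule that)
qed

lemma line_degree_le_vanishes_on_line:
  fixes L :: "('a::{field,finite} ^ 'n) set"
  assumes f: "line_degree_le d f" and L: "is_line L"
    and S: "S \<subseteq> L" "d < card S" "\<And>y. y \<in> S \<Longrightarrow> f y = 0" and y: "y \<in> L"
  shows "f y = 0"
proof -
  obtain p v where L': "L = range (\<lambda>t. p + t *s v)"
    using L by (rule is_lineE)
  obtain P where P: "degree P \<le> d" "\<And>t. f (p + t *s v) = poly P t"
    using f by (rule line_degree_leE[where p = p and v = v]) blast
  \<comment> \<open>\<open>S\<close> is covered by an image of the root set of \<open>P\<close>, so
    a nonzero \<open>P\<close> would have more than \<open>d\<close> roots.\<close>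
  have "S \<subseteq> (\<lambda>t. p + t *s v) ` {t. poly P t = 0}"
  proof
    fix s assume "s \<in> S"
    then obtain t where t: "s = p + t *s v" using S(1) L' by blast
    then have "poly P t = 0" using S(3) \<open>s \<in> S\<close> P(2) by metis
    then show "s \<in> (\<lambda>t. p + t *s v) ` {t. poly P t = 0}" using t by blast
  qed
  then have "card S \<le> card {t. poly P t = 0}"
    by (rule surj_card_le[rotated]) simp
  then have "P = 0"
    using S(2) P(1) card_poly_roots_bound[of P] by force
  then show ?thesis using y L' P(2) by auto
qed

section \<open>Abstract interpolation and counting of functions\<close>

text \<open>Newton interpolation in the abstract: ordered by the weight \<open>w\<close>, the
  evaluation matrix is triangular with nonzero diagonal, so values can be corrected point by point
  without disturbing earlier ones.\<close>

lemma triangular_interpolation: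
  fixes w :: "'p \<Rightarrow> nat" and V :: "('p \<Rightarrow> 'a::field) set"
  assumes "finite Z" and zero: "(\<lambda>_. 0) \<in> V"
    and add: "\<And>f g. f \<in> V \<Longrightarrow> g \<in> V \<Longrightarrow> (\<lambda>y. f y + g y) \<in> V"
    and scale: "\<And>f c. f \<in> V \<Longrightarrow> (\<lambda>y. c * f y) \<in> V"
    and "\<And>z. z \<in> Z \<Longrightarrow> \<exists>f\<in>V. f z \<noteq> 0 \<and> (\<forall>z'\<in>Z. z' \<noteq> z \<longrightarrow> w z' \<le> w z \<longrightarrow> f z' = 0)"
  shows "\<exists>f\<in>V. \<forall>z\<in>Z. f z = h z"
  using assms(1,5)
\<comment> \<open>Points enter in order of nondecreasing \<open>w\<close>, so the witness for a new
  point \<open>z\<close> vanishes on all earlier points.\<close>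
proof (induction rule: finite_ranking_induct[where f = w])
  case empty
  then show ?case using zero by auto
next
  case (insert z S)
  have "\<exists>f\<in>V. \<forall>z\<in>S. f z = h z"
    using insert.prems by (intro insert.IH) blast
  then obtain f where f: "f \<in> V" "\<And>s. s \<in> S \<Longrightarrow> f s = h s" by blast
  show ?case
  \<comment> \<open>The induction rule allows \<open>z\<close> to be present already.\<close>
  proof (cases "z \<in> S")
    case True
    then show ?thesis using f by auto
  next
    case False
    obtain g where g: "g \<in> V" "g z \<noteq> 0" "\<And>s. s \<in> S \<Longrightarrow> g s = 0"
      using insert.prems[of z] insert.hyps False by (metis insertCI)
    have "(\<lambda>y. f y + (h z - f z) / g z * g y) \<in> V"
      by (intro add scale f g)
    then show ?thesis
      using f g by (intro bexI[of _ "\<lambda>y. f y + (h z - f z) / g z * g y"]) auto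
  qed
qed

text \<open>Two interpolants that agree on \<open>Y\<close> differ by a member of \<open>V\<close>
  vanishing on \<open>Y\<close>, hence on \<open>Z\<close>; so restriction to \<open>Y\<close>
  embeds the functions on \<open>Z\<close> into those on \<open>Y\<close>. Over a finite field,
  counting functions replaces comparing dimensions.\<close>

lemma card_le_if_interpolation:
  fixes V :: "('p \<Rightarrow> 'a::{field,finite}) set"
  assumes "finite Y" "finite Z"
    and diff: "\<And>f g. f \<in> V \<Longrightarrow> g \<in> V \<Longrightarrow> (\<lambda>y. f y - g y) \<in> V"
    and vanish: "\<And>f z. f \<in> V \<Longrightarrow> (\<And>y. y \<in> Y \<Longrightarrow> f y = 0) \<Longrightarrow> z \<in> Z \<Longrightarrow> f z = 0"
    and interp: "\<And>h. \<exists>f\<in>V. \<forall>z\<in>Z. f z = h z"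
  shows "card Z \<le> card Y"
proof -
  obtain F where F: "\<And>h. F h \<in> V" "\<And>h z. z \<in> Z \<Longrightarrow> F h z = h z"
    using interp by metis
  have "inj_on (\<lambda>h. restrict (F h) Y) (Z \<rightarrow>\<^sub>E UNIV)"
  proof (rule inj_onI)
    fix h k assume hk: "h \<in> Z \<rightarrow>\<^sub>E UNIV" "k \<in> Z \<rightarrow>\<^sub>E UNIV" and eq: "restrict (F h) Y = restrict (F k) Y"
    have "F h y - F k y = 0" if "y \<in> Y" for y
      using fun_cong[OF eq, of y] that by simp
    then have "F h z - F k z = 0" if "z \<in> Z" for z
      using vanish[OF diff[OF F(1) F(1)]] that by blast
    then show "h = k"
      using F(2) hk by (intro PiE_ext[OF hk]) simp
  qed
  then have "card (Z \<rightarrow>\<^sub>E (UNIV :: 'a set)) \<le> card (Y \<rightarrow>\<^sub>E (UNIV :: 'a set))"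
    by (rule card_inj_on_le) (use assms(1) in \<open>auto intro: finite_PiE\<close>)
  then have "CARD('a) ^ card Z \<le> CARD('a) ^ card Y"
    using assms(1,2) by (simp add: card_funcsetE)
  \<comment> \<open>The base is at least 2, which lets the exponents be compared.\<close>
  moreover have "card {0, 1 :: 'a} \<le> CARD('a)"
    by (rule card_mono) auto
  ultimately show ?thesis
    by (simp add: power_le_imp_le_exp)
qed

section \<open>Lattice points of the simplex\<close>

definition simplex_indices :: "nat \<Rightarrow> ('n::finite \<Rightarrow> nat) set" where
  "simplex_indices d = {a. (\<Sum>i\<in>UNIV. a i) \<le> d}"

lemma simplex_indices_le: "a \<in> simplex_indices d \<Longrightarrow> a i \<le> d"
  unfolding simplex_indices_def
  using member_le_sum[of i UNIV a] by fastforce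

lemma finite_simplex_indices: "finite (simplex_indices d :: ('n::finite \<Rightarrow> nat) set)"
proof (rule finite_subset)
  show "simplex_indices d \<subseteq> (UNIV :: 'n set) \<rightarrow>\<^sub>E {..d}"
    using simplex_indices_le by (auto simp: PiE_UNIV_domain)
qed (auto intro: finite_PiE)

text \<open>Stars and bars: dropping the last entry, a slack variable, maps the lists of length
  \<open>CARD('n) + 1\<close> with sum \<open>d\<close> injectively into the index set.\<close>

lemma card_simplex_indices_ge:
  "(CARD('n) + d) choose d \<le> card (simplex_indices d :: ('n::finite \<Rightarrow> nat) set)"
proof -
  obtain e :: "'n \<Rightarrow> nat" where e: "bij_betw e UNIV {0..<CARD('n)}"
    using ex_bij_betw_finite_nat[of "UNIV :: 'n set"] by auto
  let ?T = "{l :: nat list. length l = Suc CARD('n) \<and> sum_list l = d}"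
  let ?\<phi> = "\<lambda>l i. l ! e i"
  have split: "(\<Sum>i\<in>UNIV. l ! e i) + l ! CARD('n) = d" if "l \<in> ?T" for l
    using that sum.reindex_bij_betw[OF e, of "(!) l"] by (auto simp: sum_list_sum_nth)
  have "inj_on ?\<phi> ?T"
  proof (rule inj_onI)
    fix l m assume lm: "l \<in> ?T" "m \<in> ?T" and eq: "?\<phi> l = ?\<phi> m"
    have "l ! k = m ! k" if "k < Suc CARD('n)" for k
    proof (cases "k = CARD('n)")
      case True
      then show ?thesis using split[OF lm(1)] split[OF lm(2)] fun_cong[OF eq] by simp
    next
      case False
      then have "k \<in> range e"
        using that bij_betw_imp_surj_on[OF e] by simp
      then obtain i where "k = e i" by blast
      then show ?thesis using fun_cong[OF eq, of i] by simp
    qed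
    then show "l = m" using lm by (intro nth_equalityI) auto
  qed
  moreover have "?\<phi> ` ?T \<subseteq> simplex_indices d"
  proof
    fix a assume "a \<in> ?\<phi> ` ?T"
    then obtain l where "l \<in> ?T" "a = ?\<phi> l" by blast
    then show "a \<in> simplex_indices d"
      using split[of l] by (simp add: simplex_indices_def)
  qed
  ultimately have "card ?T \<le> card (simplex_indices d :: ('n \<Rightarrow> nat) set)"
    using finite_simplex_indices by (rule card_inj_on_le)
  then show ?thesis
    by (simp add: card_length_sum_list add.commute)
qed

text \<open>The right side is the product \<open>(d + 1) * ... * (d + n)\<close>, whose
  \<open>n\<close> factors are each at least \<open>d + 1\<close>.\<close>

lemma power_le_fact_mult_binomial: "Suc d ^ n \<le> fact n * ((n + d) choose d)"
proof -
  have "Suc d ^ n = (\<Prod>i<n. Suc d)" by simp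
  also have "\<dots> \<le> (\<Prod>i<n. Suc d + i)" by (rule prod_mono) simp
  also have "\<dots> = pochhammer (Suc d) n"
    by (simp add: pochhammer_prod atLeast0LessThan)
  \<comment> \<open>The factor \<open>fact d\<close> completes the rising product to
    \<open>fact (n + d)\<close>.\<close>
  finally have "Suc d ^ n * fact d \<le> pochhammer (Suc d) n * fact d"
    by simp
  also have "\<dots> = fact (n + d)"
    using pochhammer_product'[of "1 :: nat" d n] by (simp add: pochhammer_fact add.commute mult.commute)
  also have "\<dots> = fact n * ((n + d) choose d) * fact d"
    using binomial_fact_lemma[of d "n + d"] by (simp add: mult_ac)
  finally show ?thesis by simp
qed

section \<open>Newton interpolation on the simplex and its translates\<close>

lemma inj_on_simplex_point:
  assumes "inj_on x {..d}"
  shows "inj_on (\<lambda>a :: 'n::finite \<Rightarrow> nat. \<chi> i. x (a i)) (simplex_indices d)"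
proof (rule inj_onI)
  fix a b :: "'n \<Rightarrow> nat"
  assume ab: "a \<in> simplex_indices d" "b \<in> simplex_indices d"
    and eq: "(\<chi> i. x (a i)) = (\<chi> i. x (b i))"
  have "x (a i) = x (b i)" for i
    using eq by (simp add: vec_eq_iff)
  then show "a = b"
    using ab assms by (intro ext) (meson atMost_iff inj_onD simplex_indices_le)
qed

lemma simplex_interpolation:
  fixes x :: "nat \<Rightarrow> 'a::{field,finite}"
  assumes x: "inj_on x {..d}"
  defines "B \<equiv> (\<lambda>a. \<chi> i. x (a i)) ` (simplex_indices d :: ('n::finite \<Rightarrow> nat) set)"
  shows "\<exists>f. line_degree_le d f \<and> (\<forall>y\<in>B. f y = h y)"
proof -
  let ?I = "simplex_indices d :: ('n \<Rightarrow> nat) set"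
  let ?\<pi> = "\<lambda>a. (\<chi> i. x (a i)) :: 'a ^ 'n"
  have inj: "inj_on ?\<pi> ?I"
    using x by (rule inj_on_simplex_point)
  \<comment> \<open>The weight of a point is the sum of its indices, recovered by inverting the
    point map.\<close>
  define w where "w z = (\<Sum>i\<in>UNIV. inv_into ?I ?\<pi> z i)" for z
  have w: "w (?\<pi> a) = (\<Sum>i\<in>UNIV. a i)" if "a \<in> ?I" for a
    unfolding w_def inv_into_f_f[OF inj that] ..
  have "\<exists>f\<in>Collect (line_degree_le d). f z \<noteq> 0 \<and> (\<forall>z'\<in>B. z' \<noteq> z \<longrightarrow> w z' \<le> w z \<longrightarrow> f z' = 0)"
    if z: "z \<in> B" for z
  proof -
    obtain a where a: "a \<in> ?I" "z = ?\<pi> a" using z unfolding B_def by blast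
    \<comment> \<open>The Newton basis polynomial of \<open>a\<close>: its degree is at most the sum
      of the \<open>a i\<close>, and it vanishes at the point of \<open>b\<close> as soon as some
      \<open>b i < a i\<close>.\<close>
    define f where "f y = (\<Prod>i\<in>UNIV. \<Prod>j<a i. y $ i - x j)" for y :: "'a ^ 'n"
    have "line_degree_le (\<Sum>i\<in>UNIV. \<Sum>j<a i. 1) f"
      unfolding f_def by (intro line_degree_le_prod line_degree_le_coordinate)
    then have "line_degree_le d f"
      using a(1) by (auto simp: simplex_indices_def intro: line_degree_le_mono)
    moreover have "f z \<noteq> 0"
    proof -
      have "x (a i) \<noteq> x j" if "j < a i" for i j
        using that simplex_indices_le[OF a(1), of i] inj_onD[OF x, of "a i" j] by force
      then show ?thesis using a(2) by (simp add: f_def)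
    qed
    moreover have "f z' = 0" if z': "z' \<in> B" "z' \<noteq> z" "w z' \<le> w z" for z'
    proof -
      obtain b where b: "b \<in> ?I" "z' = ?\<pi> b" using z'(1) unfolding B_def by blast
      \<comment> \<open>Otherwise \<open>b\<close> dominates \<open>a\<close> in every coordinate,
        and the weight comparison forces \<open>a = b\<close>.\<close>
      have "\<exists>i. b i < a i"
      proof (rule ccontr)
        assume "\<nexists>i. b i < a i"
        then have le: "\<And>i. a i \<le> b i" by (simp add: not_less)
        moreover have "(\<Sum>i\<in>UNIV. b i) \<le> (\<Sum>i\<in>UNIV. a i)"
          using z'(3) a b w by simp
        ultimately have "a i = b i" for i
          by (intro sum_mono_inv[of a UNIV b]) (auto intro: antisym sum_mono)
        then have "a = b" by blast
        then show False using z'(2) a b by simp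
      qed
      then show ?thesis
        using b(2) by (auto simp: f_def)
    qed
    ultimately show ?thesis by blast
  qed
  then have "\<exists>f\<in>Collect (line_degree_le d). \<forall>z\<in>B. f z = h z"
    by (intro triangular_interpolation[where w = w])
       (auto simp: line_degree_le_const line_degree_le_add line_degree_le_cmult)
  then show ?thesis by blast
qed

lemma exists_translation_interpolating_set:
  assumes d: "d < CARD('a)"
  obtains B :: "('a::{field,finite} ^ 'n) set"
  where "Suc d ^ CARD('n) \<le> fact CARD('n) * card B"
    and "\<And>g h. \<exists>f. line_degree_le d f \<and> (\<forall>y\<in>B. f (y + g) = h y)"
proof -
  obtain x :: "nat \<Rightarrow> 'a" where "bij_betw x {0..<CARD('a)} UNIV"
    using ex_bij_betw_nat_finite[of "UNIV :: 'a set"] by auto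
  \<comment> \<open>As \<open>d < CARD('a)\<close>, there are \<open>d + 1\<close> distinct nodes
    \<open>x 0, ..., x d\<close>.\<close>
  then have x: "inj_on x {..d}"
    using d by (auto simp: bij_betw_def intro: inj_on_subset)
  define B where "B = (\<lambda>a. (\<chi> i. x (a i)) :: 'a ^ 'n) ` simplex_indices d"
  have "card B = card (simplex_indices d :: ('n \<Rightarrow> nat) set)"
    unfolding B_def using inj_on_simplex_point[OF x] by (rule card_image)
  then have "Suc d ^ CARD('n) \<le> fact CARD('n) * card B"
    using power_le_fact_mult_binomial[of d "CARD('n)"] card_simplex_indices_ge[of d, where 'n = 'n]
    by (metis mult_le_mono2 order_trans)
  moreover have "\<exists>f. line_degree_le d f \<and> (\<forall>y\<in>B. f (y + g) = h y)" for g h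
  proof -
    obtain f where "line_degree_le d f" "\<forall>y\<in>B. f y = h y"
      using simplex_interpolation[OF x, of h] unfolding B_def by blast
    \<comment> \<open>Translating the interpolant keeps its degree bound, so one \<open>B\<close>
      serves every \<open>g\<close>.\<close>
    then show ?thesis
      by (intro exI[of _ "\<lambda>y. f (y - g)"]) (simp add: line_degree_le_translate)
  qed
  ultimately show thesis by (rule that)
qed

section \<open>Averaging over translates\<close>

text \<open>Double counting of the pairs \<open>(b, g)\<close> with \<open>b + g \<in> X\<close>:
  for fixed \<open>b\<close> the admissible \<open>g\<close> form a translate of
  \<open>X\<close>.\<close>

lemma sum_card_translates:
  fixes B X :: "'g::{ab_group_add,finite} set"
  shows "(\<Sum>g\<in>UNIV. card {b\<in>B. b + g \<in> X}) = card B * card X"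
proof -
  have "(\<Sum>g\<in>UNIV. card {b\<in>B. b + g \<in> X}) = (\<Sum>b\<in>B. card {g. b + g \<in> X})"
    using sum_multicount_gen[of UNIV B "\<lambda>g b. b + g \<in> X" "\<lambda>b. card {g. b + g \<in> X}"] by simp
  also have "\<dots> = (\<Sum>b\<in>B. card X)"
  proof (rule sum.cong)
    fix b
    have "{g. b + g \<in> X} = (\<lambda>y. y - b) ` X"
      by (auto simp: image_iff algebra_simps intro!: bexI[of _ "b + _"])
    then show "card {g. b + g \<in> X} = card X"
      by (simp add: card_image inj_on_def)
  qed simp
  finally show ?thesis by simp
qed

text \<open>The hypothesis \<open>closure\<close> places \<open>X\<close> in the
  degree-\<open>d\<close> closure of \<open>Y\<close>, so no translate of \<open>B\<close> meets
  \<open>X\<close> in more than \<open>card Y\<close> points; summing over all translations bounds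
  \<open>card X\<close>.\<close>

lemma degree_closure_bound:
  fixes X Y :: "('a::{field,finite} ^ 'n) set"
  assumes d: "d < CARD('a)"
    and closure: "\<And>f y. line_degree_le d f \<Longrightarrow> (\<And>y. y \<in> Y \<Longrightarrow> f y = 0) \<Longrightarrow> y \<in> X \<Longrightarrow> f y = 0"
  shows "Suc d ^ CARD('n) * card X \<le> fact CARD('n) * CARD('a) ^ CARD('n) * card Y"
proof -
  obtain B :: "('a ^ 'n) set" where B: "Suc d ^ CARD('n) \<le> fact CARD('n) * card B"
    and interp: "\<And>g h. \<exists>f. line_degree_le d f \<and> (\<forall>y\<in>B. f (y + g) = h y)"
    using d by (rule exists_translation_interpolating_set) blast
  have "card {b\<in>B. b + g \<in> X} \<le> card Y" for g
  proof -
    \<comment> \<open>The count passes to the translated points, where both interpolation and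
      \<open>closure\<close> apply.\<close>
    have "card ((\<lambda>b. b + g) ` {b\<in>B. b + g \<in> X}) \<le> card Y"
    proof (rule card_le_if_interpolation[where V = "Collect (line_degree_le d)"])
      fix h
      obtain f where "line_degree_le d f" "\<forall>y\<in>B. f (y + g) = h (y + g)"
        using interp[of g "\<lambda>y. h (y + g)"] by blast
      then show "\<exists>f\<in>Collect (line_degree_le d). \<forall>z\<in>(\<lambda>b. b + g) ` {b\<in>B. b + g \<in> X}. f z = h z"
        by blast
    qed (auto simp: line_degree_le_diff intro: closure)
    then show ?thesis by (simp add: card_image)
  qed
  then have "(\<Sum>g\<in>UNIV. card {b\<in>B. b + g \<in> X}) \<le> (\<Sum>g\<in>(UNIV :: ('a ^ 'n) set). card Y)"
    by (intro sum_mono)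
  then have "card B * card X \<le> CARD('a) ^ CARD('n) * card Y"
    by (simp add: sum_card_translates)
  then have translates: "fact CARD('n) * (card B * card X)
      \<le> fact CARD('n) * (CARD('a) ^ CARD('n) * card Y)"
    by simp
  have "Suc d ^ CARD('n) * card X \<le> fact CARD('n) * card B * card X"
    using B by (rule mult_le_mono1)
  also have "\<dots> = fact CARD('n) * (card B * card X)"
    by (simp only: mult.assoc)
  also note translates
  finally show ?thesis by (simp only: mult.assoc)
qed

section \<open>Choice of the degree and the final estimate\<close>

theorem corollary5p9:
  fixes q n c :: nat
    and \<alpha> :: real
    and L \<gamma> :: "nat \<Rightarrow> ('a::{field,finite} ^ 'n) set"
    and X Y :: "('a ^ 'n) set"
  assumes "CARD('a) = q" and "CARD('n) = n"
    and "0 < \<alpha>" and "\<alpha> < 1"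
    and "\<And>i. i \<in> {1..c} \<Longrightarrow> is_line (L i)"
    and "X = (\<Union>i\<in>{1..c}. L i)"
    and "\<And>i. i \<in> {1..c} \<Longrightarrow> \<gamma> i \<subseteq> L i"
    and "\<And>i. i \<in> {1..c} \<Longrightarrow> real (card (\<gamma> i)) > real q powr \<alpha>"
    and "Y = (\<Union>i\<in>{1..c}. \<gamma> i)"
  shows "real (card X) \<le> fact n * real q powr (real n * (1 - \<alpha>)) * real (card Y)"
proof -
  \<comment> \<open>The largest natural number not above \<open>real q powr \<alpha>\<close>: every
    \<open>\<gamma> i\<close> has more than \<open>d\<close> points, while \<open>d + 1\<close>
    still exceeds \<open>real q powr \<alpha>\<close>.\<close>
  define d where "d = nat \<lfloor>real q powr \<alpha>\<rfloor>"
  have "card {0, 1 :: 'a} \<le> CARD('a)"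
    by (rule card_mono) auto
  then have q: "1 < real q" using assms(1) by simp
  have d_le: "real d \<le> real q powr \<alpha>" and d_gt: "real q powr \<alpha> < real (Suc d)"
    unfolding d_def by (simp_all add: of_nat_nat) linarith
  \<comment> \<open>Here \<alpha> < 1 secures \<open>d < q\<close>, so that the field holds
    \<open>d + 1\<close> nodes.\<close>
  have "real q powr \<alpha> < real q powr 1"
    using q assms(4) by (intro powr_less_mono)
  then have "d < CARD('a)" using d_le q assms(1) by simp
  moreover have "f y = 0"
    if f: "line_degree_le d f" "\<And>y. y \<in> Y \<Longrightarrow> f y = 0" and y: "y \<in> X" for f y
  proof -
    obtain i where i: "i \<in> {1..c}" "y \<in> L i" using y assms(6) by blast
    have "d < card (\<gamma> i)" using assms(8)[OF i(1)] d_le by linarith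
    moreover have "f z = 0" if "z \<in> \<gamma> i" for z
      using that i(1) assms(9) f(2) by blast
    ultimately show ?thesis
      using line_degree_le_vanishes_on_line[OF f(1) assms(5)[OF i(1)] assms(7)[OF i(1)]] i(2) by blast
  qed
  ultimately have "Suc d ^ n * card X \<le> fact n * q ^ n * card Y"
    using degree_closure_bound[of d Y X] assms(1,2) by blast
  then have "real (Suc d ^ n * card X) \<le> real (fact n * q ^ n * card Y)"
    by (rule of_nat_mono)
  then have bound: "real (Suc d) ^ n * card X \<le> fact n * real q ^ n * card Y"
    by simp
  have "(real q powr \<alpha>) ^ n * card X \<le> real (Suc d) ^ n * card X"
    using d_gt by (intro mult_right_mono power_mono) auto
  also note bound
  \<comment> \<open>Splitting off \<open>(real q powr \<alpha>) ^ n\<close> leaves exactly the power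
    of \<open>q\<close> in the claim; this positive factor then cancels.\<close>
  also have "real q ^ n = (real q powr \<alpha>) ^ n * real q powr (real n * (1 - \<alpha>))"
    using q by (simp add: powr_powr algebra_simps flip: powr_realpow powr_add)
  finally have "(real q powr \<alpha>) ^ n * card X
      \<le> (real q powr \<alpha>) ^ n * (fact n * real q powr (real n * (1 - \<alpha>)) * card Y)"
    by (simp add: mult_ac)
  then show ?thesis
    using q by simp
qed

end
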